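(* A quasi-lattice $(P,\leq)$ is associative if and only if it is a lattice.
   Context: Let $(P,\leq)$ be a poset on a nonempty set $P$. An element $m\in P$ is a maximal lower bound of a nonempty subset $S\subseteq P$ if $m\leq s$ for all $s\in S$ and there is no $d\in P$ with $m<d\leq s$ for all $s\in S$; a minimal upper bound is defined dually. $(P,\leq)$ is a quasi-lattice if any two elements of $P$ have at least one minimal upper bound and at least one maximal lower bound (these need not be unique). For subsets $A,B\subseteq P$, $A\vee B$ denotes the set of all elements of $P$ that are a minimal upper bound of $\{a,b\}$ for some $a\in A$, $b\in B$, and $A\wedge B$ denotes the set of all elements of $P$ that are a maximal lower bound of $\{a,b\}$ for some $a\in A$, $b\in B$. A quasi-lattice $(P,\leq)$ is called associative if for all $a,b,c\in P$: (i) $\{a\}\vee(\{b\}\vee\{c\})=(\{a\}\vee\{b\})\vee\{c\}$, and (ii) $\{a\}\wedge(\{b\}\wedge\{c\})=(\{a\}\wedge\{b\})\wedge\{c\}$ (equalities of subsets of $P$). A lattice is a poset in which any two elements have a least upper bound and a greatest lower bound. *)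

theory Defs
  imports "HOL-Algebra.Lattice"
begin

text \<open>
  Posets are HOL-Algebra structures satisfying \<open>partial_order\<close>: the underlying set is the carrier,
  and the equality component is required to be HOL equality, so \<open>\<sqsubset>\<close> is the usual strict order.
  The sets \<open>Upper\<close> and \<open>Lower\<close> consist of the upper and lower bounds inside the carrier.
\<close>

definition minimal_upper_bound :: "('a, 'm) gorder_scheme \<Rightarrow> 'a set \<Rightarrow> 'a \<Rightarrow> bool" where
  "minimal_upper_bound L S m \<longleftrightarrow>
     m \<in> Upper L S \<and> \<not> (\<exists>d \<in> Upper L S. d \<sqsubset>\<^bsub>L\<^esub> m)"

definition maximal_lower_bound :: "('a, 'm) gorder_scheme \<Rightarrow> 'a set \<Rightarrow> 'a \<Rightarrow> bool" where
  "maximal_lower_bound L S m \<longleftrightarrow>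
     m \<in> Lower L S \<and> \<not> (\<exists>d \<in> Lower L S. m \<sqsubset>\<^bsub>L\<^esub> d)"

definition set_join :: "('a, 'm) gorder_scheme \<Rightarrow> 'a set \<Rightarrow> 'a set \<Rightarrow> 'a set" where
  "set_join L A B = {m. \<exists>a\<in>A. \<exists>b\<in>B. minimal_upper_bound L {a, b} m}"

definition set_meet :: "('a, 'm) gorder_scheme \<Rightarrow> 'a set \<Rightarrow> 'a set \<Rightarrow> 'a set" where
  "set_meet L A B = {m. \<exists>a\<in>A. \<exists>b\<in>B. maximal_lower_bound L {a, b} m}"

locale quasi_lattice = partial_order +
  assumes carrier_nonempty: "carrier L \<noteq> {}"
    and minimal_upper_bound_exists:
      "\<lbrakk>x \<in> carrier L; y \<in> carrier L\<rbrakk> \<Longrightarrow> \<exists>m. minimal_upper_bound L {x, y} m"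
    and maximal_lower_bound_exists:
      "\<lbrakk>x \<in> carrier L; y \<in> carrier L\<rbrakk> \<Longrightarrow> \<exists>m. maximal_lower_bound L {x, y} m"

locale associative_quasi_lattice = quasi_lattice +
  assumes set_join_assoc:
      "\<lbrakk>a \<in> carrier L; b \<in> carrier L; c \<in> carrier L\<rbrakk> \<Longrightarrow>
        set_join L {a} (set_join L {b} {c}) = set_join L (set_join L {a} {b}) {c}"
    and set_meet_assoc:
      "\<lbrakk>a \<in> carrier L; b \<in> carrier L; c \<in> carrier L\<rbrakk> \<Longrightarrow>
        set_meet L {a} (set_meet L {b} {c}) = set_meet L (set_meet L {a} {b}) {c}"

end

theory Submission
  imports Defs
begin

text \<open>
  If \<open>u\<close> is an upper bound of \<open>a\<close> and \<open>b\<close>, then \<open>{a} \<or> ({b} \<or> {u}) = {u}\<close>, so associativity gives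
  \<open>({a} \<or> {b}) \<or> {u} = {u}\<close>. Hence every minimal upper bound \<open>m\<close> of \<open>a\<close> and \<open>b\<close> satisfies
  \<open>{m} \<or> {u} = {u}\<close>, that is \<open>m \<le> u\<close>, and \<open>m\<close> is the least upper bound. Conversely, in a lattice
  the set-valued operations are the singletons of the usual ones. The order dual gives meets.
\<close>

context partial_order
begin

text \<open>These four rewrite rules turn facts about joins in the dual order into facts about meets
  in \<open>L\<close>, so that each argument is needed for joins only.\<close>

lemma lless_dual [simp]: "x \<sqsubset>\<^bsub>inv_gorder L\<^esub> y \<longleftrightarrow> y \<sqsubset> x"
  by (auto simp: lless_def eq_is_equal)

lemma minimal_upper_bound_dual [simp]:
  "minimal_upper_bound (inv_gorder L) S m \<longleftrightarrow> maximal_lower_bound L S m"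
  by (simp add: maximal_lower_bound_def minimal_upper_bound_def)

lemma maximal_lower_bound_dual [simp]:
  "maximal_lower_bound (inv_gorder L) S m \<longleftrightarrow> minimal_upper_bound L S m"
  by (simp add: maximal_lower_bound_def minimal_upper_bound_def)

lemma set_join_dual [simp]: "set_join (inv_gorder L) A B = set_meet L A B"
  by (simp add: set_join_def set_meet_def)

text \<open>Any upper bound other than \<open>l\<close> lies strictly above \<open>l\<close> and so
  is not minimal.\<close>

lemma minimal_upper_bound_eq_least:
  assumes "least L l (Upper L S)"
  shows "minimal_upper_bound L S m \<longleftrightarrow> m = l"
proof -
  have "l \<in> Upper L S" "l \<in> carrier L" "\<And>x. x \<in> Upper L S \<Longrightarrow> x \<in> carrier L \<and> l \<sqsubseteq> x"
    using assms by (auto simp: least_def Upper_def)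
  then show ?thesis
    unfolding minimal_upper_bound_def lless_eq by (metis le_antisym)
qed

lemma set_join_singletons_of_least:
  assumes "least L l (Upper L {a, b})"
  shows "set_join L {a} {b} = {l}"
  by (simp add: set_join_def minimal_upper_bound_eq_least [OF assms])

lemma set_join_singletons_of_le:
  assumes "a \<in> carrier L" "b \<in> carrier L" "a \<sqsubseteq> b"
  shows "set_join L {a} {b} = {b}"
  using assms by (intro set_join_singletons_of_least least_UpperI) (auto simp: Upper_def)

end

text \<open>Only the join law is assumed, and as a hypothesis, so that the lemma also applies to the
  dual order, where that law is associativity of \<open>set_meet\<close>.\<close>

lemma (in quasi_lattice) least_if_minimal_upper_bound:
  assumes assoc: "\<And>a b c. \<lbrakk>a \<in> carrier L; b \<in> carrier L; c \<in> carrier L\<rbrakk> \<Longrightarrow>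
      set_join L {a} (set_join L {b} {c}) = set_join L (set_join L {a} {b}) {c}"
    and a: "a \<in> carrier L" and b: "b \<in> carrier L"
    and m: "minimal_upper_bound L {a, b} m"
  shows "least L m (Upper L {a, b})"
proof -
  have m_upper: "m \<in> Upper L {a, b}"
    using m by (simp add: minimal_upper_bound_def)
  have "m \<sqsubseteq> u" if u: "u \<in> Upper L {a, b}" for u
  proof -
    have carr: "u \<in> carrier L" "m \<in> carrier L"
      using u m_upper by (simp_all add: Upper_def)
    have "a \<sqsubseteq> u" "b \<sqsubseteq> u"
      using u a b by (simp_all add: Upper_def)
    then have eq: "set_join L (set_join L {a} {b}) {u} = {u}"
      using a b carr by (simp flip: assoc add: set_join_singletons_of_le)
    \<comment> \<open>Existence of minimal upper bounds makes \<open>{m} \<or> {u}\<close> nonempty;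
      otherwise its inclusion in \<open>{u}\<close> would say nothing about
      \<open>m\<close>.\<close>
    obtain k where k: "minimal_upper_bound L {m, u} k"
      using minimal_upper_bound_exists carr by blast
    then have "k \<in> set_join L (set_join L {a} {b}) {u}"
      using m by (auto simp: set_join_def)
    then have "k = u"
      using eq by simp
    then show ?thesis
      using k carr by (simp add: minimal_upper_bound_def Upper_def)
  qed
  then show ?thesis
    using m_upper by (simp add: least_def)
qed

lemma (in quasi_lattice) dual_quasi_lattice: "quasi_lattice (inv_gorder L)"
proof -
  interpret dual: partial_order "inv_gorder L"
    by (rule dual_order)
  show ?thesis
    by unfold_locales
      (simp_all add: carrier_nonempty minimal_upper_bound_exists maximal_lower_bound_exists)
qed

lemma (in associative_quasi_lattice) is_lattice: "lattice L"
proof unfold_locales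
  fix x y assume xy: "x \<in> carrier L" "y \<in> carrier L"
  show "\<exists>s. least L s (Upper L {x, y})"
    using minimal_upper_bound_exists [OF xy] least_if_minimal_upper_bound [OF set_join_assoc xy]
    by blast
  interpret dual: quasi_lattice "inv_gorder L"
    by (rule dual_quasi_lattice)
  obtain m where "maximal_lower_bound L {x, y} m"
    using maximal_lower_bound_exists [OF xy] by blast
  then have "least (inv_gorder L) m (Upper (inv_gorder L) {x, y})"
    using xy by (intro dual.least_if_minimal_upper_bound)
      (simp_all add: set_meet_assoc)
  then show "\<exists>s. greatest L s (Lower L {x, y})"
    by (simp only: least_dual Upper_dual) blast
qed

lemma (in lattice) set_join_singletons:
  assumes "a \<in> carrier L" "b \<in> carrier L"
  shows "set_join L {a} {b} = {a \<squnion> b}"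
  \<comment> \<open>\<open>joinI\<close> reduces a claim about \<open>a \<squnion> b\<close> to one
    about an arbitrary least upper bound.\<close>
  by (rule joinI [OF _ assms]) (rule set_join_singletons_of_least)

lemma (in lattice) set_join_assoc_singletons:
  assumes "a \<in> carrier L" "b \<in> carrier L" "c \<in> carrier L"
  shows "set_join L {a} (set_join L {b} {c}) = set_join L (set_join L {a} {b}) {c}"
  using assms weak_join_assoc [OF assms] by (simp add: set_join_singletons eq_is_equal)

theorem theorem2p3:
  fixes P :: "('a, 'm) gorder_scheme"
  assumes "quasi_lattice P"
  shows "associative_quasi_lattice P \<longleftrightarrow> lattice P"
proof
  assume "associative_quasi_lattice P"
  then show "lattice P"
    by (rule associative_quasi_lattice.is_lattice)
next
  assume "lattice P"
  then interpret lattice P .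
  interpret quasi_lattice P
    by (fact assms)
  show "associative_quasi_lattice P"
    \<comment> \<open>The second fact is the join law of the dual lattice, which
      \<open>set_join_dual\<close> rewrites to the meet law.\<close>
    using set_join_assoc_singletons lattice.set_join_assoc_singletons [OF dual_lattice]
    by unfold_locales simp_all
qed

end
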